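(* Let $n\ge2$, let $w$ be a Coxeter element in $\mathrm{Tog}(\mathcal Z_n)$, and let $\chi_{a_j}:J(\mathcal Z_n)\to\{0,1\}$ be the indicator function of $a_j$ (so $\chi_{a_j}(I)=1$ iff $a_j\in I$). Then on $w$-orbits in $J(\mathcal Z_n)$ the following statistics are homomesic. (i) If $n$ is odd, then $\chi_{a_j}-\chi_{a_{n+1-j}}$ is $0$-mesic for every $j\in[n]$; also $2\chi_{a_1}-\chi_{a_2}$ and $2\chi_{a_n}-\chi_{a_{n-1}}$ are both $1$-mesic. (ii) If $n$ is even, then $\chi_{a_j}+\chi_{a_{n+1-j}}$ is $1$-mesic for every $j\in[n]$; also $2\chi_{a_1}-\chi_{a_2}$ is $1$-mesic and $2\chi_{a_n}-\chi_{a_{n-1}}$ is $0$-mesic.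
   Context: $[n]=\{1,\dots,n\}$. The zigzag poset $\mathcal Z_n$ has elements $a_1,\dots,a_n$ and relations $a_{2i-1}<a_{2i}$ and $a_{2i+1}<a_{2i}$ (whenever the indices lie in $[n]$). $J(\mathcal Z_n)$ is the set of order ideals (down-closed subsets) of $\mathcal Z_n$. For $i\in[n]$ the toggle $t_i:J(\mathcal Z_n)\to J(\mathcal Z_n)$ is: $t_i(I)=I\cup\{a_i\}$ if $a_i\notin I$ and $I\cup\{a_i\}\in J(\mathcal Z_n)$; $t_i(I)=I\setminus\{a_i\}$ if $a_i\in I$ and $I\setminus\{a_i\}\in J(\mathcal Z_n)$; and $t_i(I)=I$ otherwise. The toggle group $\mathrm{Tog}(\mathcal Z_n)$ is the group of permutations of $J(\mathcal Z_n)$ generated by $t_1,\dots,t_n$. A Coxeter element of $\mathrm{Tog}(\mathcal Z_n)$ is a product of $t_1,\dots,t_n$, each used exactly once, in some order. A function $f$ on $J(\mathcal Z_n)$ with values in a field of characteristic $0$ is $c$-mesic under $w$ if its average over every $w$-orbit equals $c$. *)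

theory Defs
  imports
    "HOL-Algebra.Bij"
    "HOL-Algebra.Generated_Groups"
    "HOL-Combinatorics.Orbits"
begin

text \<open>A poset is given by its reflexive order relation \<open>r\<close> on the ground set \<^term>\<open>Field r\<close>,
  where \<open>(x, y) \<in> r\<close> means \<open>x \<le> y\<close>.\<close>

definition order_ideals :: "('a \<times> 'a) set \<Rightarrow> 'a set set" where
  "order_ideals r = {I. I \<subseteq> Field r \<and> (\<forall>x y. y \<in> I \<and> (x, y) \<in> r \<longrightarrow> x \<in> I)}"

text \<open>Toggles are restricted to the order ideals (with value \<^const>\<open>undefined\<close> elsewhere), as
  required of elements of the group \<^term>\<open>BijGroup (order_ideals r)\<close> of permutations.\<close>

definition toggle :: "('a \<times> 'a) set \<Rightarrow> 'a \<Rightarrow> 'a set \<Rightarrow> 'a set" where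
  "toggle r a = restrict
     (\<lambda>I. if a \<notin> I \<and> I \<union> {a} \<in> order_ideals r then I \<union> {a}
          else if a \<in> I \<and> I - {a} \<in> order_ideals r then I - {a}
          else I)
     (order_ideals r)"

definition toggle_group :: "('a \<times> 'a) set \<Rightarrow> ('a set \<Rightarrow> 'a set) monoid" where
  "toggle_group r =
     BijGroup (order_ideals r)
       \<lparr>carrier := generate (BijGroup (order_ideals r)) (toggle r ` Field r)\<rparr>"

definition coxeter_elements :: "('a \<times> 'a) set \<Rightarrow> ('a set \<Rightarrow> 'a set) set" where
  "coxeter_elements r =
     {foldr (\<lambda>a g. toggle r a \<otimes>\<^bsub>toggle_group r\<^esub> g) as \<one>\<^bsub>toggle_group r\<^esub> | as.
        distinct as \<and> set as = Field r}"

text \<open>The library's \<^term>\<open>orbit w x\<close> is the set of all \<open>w\<^sup>k x\<close> with \<open>k > 0\<close>. For a permutation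
  \<open>w\<close> of a finite set this is the orbit of \<open>x\<close> under the cyclic group generated by \<open>w\<close>.\<close>

definition mesic :: "'s set \<Rightarrow> ('s \<Rightarrow> 's) \<Rightarrow> 'k::field_char_0 \<Rightarrow> ('s \<Rightarrow> 'k) \<Rightarrow> bool" where
  "mesic S w c f \<longleftrightarrow>
     (\<forall>x\<in>S. (\<Sum>y\<in>orbit w x. f y) / of_nat (card (orbit w x)) = c)"

text \<open>The element \<open>a\<^sub>i\<close> is represented by its index \<open>i \<in> {1..n}\<close>. The defining relations contain no
  chain of length two, so adding the diagonal already gives a partial order.\<close>

definition zigzag :: "nat \<Rightarrow> (nat \<times> nat) set" where
  "zigzag n = Id_on {1..n}
     \<union> {(2 * i - 1, 2 * i) | i. 2 * i - 1 \<in> {1..n} \<and> 2 * i \<in> {1..n}}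
     \<union> {(2 * i + 1, 2 * i) | i. 2 * i + 1 \<in> {1..n} \<and> 2 * i \<in> {1..n}}"

definition chi :: "'a \<Rightarrow> 'a set \<Rightarrow> 'k::field_char_0" where
  "chi a I = of_bool (a \<in> I)"

lemma Field_zigzag [simp]: "Field (zigzag n) = {1..n}"
  by (force simp: zigzag_def Field_def)

lemma partial_order_zigzag: "partial_order_on {1..n} (zigzag n)"
  unfolding partial_order_on_def preorder_on_def
proof (intro conjI)
  show "zigzag n \<subseteq> {1..n} \<times> {1..n}"
    by (auto simp: zigzag_def)
  show "refl_on {1..n} (zigzag n)"
    by (auto simp: refl_on_def zigzag_def)
  show "trans (zigzag n)"
    by (rule transI) (auto simp: zigzag_def; presburger)
  show "antisym (zigzag n)"
    by (rule antisymI) (auto simp: zigzag_def; presburger)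
qed

lemma toggle_in_order_ideals:
  "I \<in> order_ideals r \<Longrightarrow> toggle r a I \<in> order_ideals r"
  by (auto simp: toggle_def)

lemma toggle_toggle:
  assumes "I \<in> order_ideals r"
  shows "toggle r a (toggle r a I) = I"
proof -
  have "a \<in> I \<Longrightarrow> insert a (I - {a}) = I" "a \<notin> I \<Longrightarrow> I - {a} = I"
    by auto
  then show ?thesis
    using assms by (auto simp: toggle_def)
qed

lemma toggle_in_BijGroup: "toggle r a \<in> carrier (BijGroup (order_ideals r))"
proof -
  have "bij_betw (toggle r a) (order_ideals r) (order_ideals r)"
    by (rule bij_betw_byWitness[where f' = "toggle r a"])
       (auto simp: toggle_toggle toggle_in_order_ideals)
  then show ?thesis
    by (auto simp: BijGroup_def Bij_def toggle_def)
qed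

lemma group_toggle_group: "group (toggle_group r)"
proof -
  have "subgroup (generate (BijGroup (order_ideals r)) (toggle r ` Field r))
          (BijGroup (order_ideals r))"
    by (rule group.generate_is_subgroup[OF group_BijGroup]) (auto simp: toggle_in_BijGroup)
  then show ?thesis
    unfolding toggle_group_def by (rule subgroup.subgroup_is_group[OF _ group_BijGroup])
qed

lemma coxeter_elements_subset: "coxeter_elements r \<subseteq> carrier (toggle_group r)"
proof -
  interpret T: group "toggle_group r" by (rule group_toggle_group)
  have "toggle r a \<in> carrier (toggle_group r)" if "a \<in> Field r" for a
    using that by (auto simp: toggle_group_def intro: generate.incl)
  then have "foldr (\<lambda>a g. toggle r a \<otimes>\<^bsub>toggle_group r\<^esub> g) as \<one>\<^bsub>toggle_group r\<^esub>
      \<in> carrier (toggle_group r)" if "set as \<subseteq> Field r" for as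
    using that by (induction as) auto
  then show ?thesis
    by (auto simp: coxeter_elements_def)
qed

end

theory Submission
  imports Defs
begin

text \<open>Reading \<open>a\<^sub>j\<close> as a particle for even \<open>j\<close> and its absence as a particle for odd \<open>j\<close> turns order
  ideals into particle configurations on a path with no two neighbours occupied; toggling \<open>j\<close> makes
  it occupied iff \<open>j\<close> and its neighbours were all vacant. Let \<open>h j\<close> be the number of \<open>i < j\<close> for which
  \<open>i + 1\<close> is toggled before \<open>i\<close>, and write \<open>x k j\<close> for the occupation of site \<open>j\<close> after \<open>k + h j\<close> steps.
  This shear makes the board \<open>x\<close> obey the same local rule for every Coxeter element, and keeps the
  number \<open>X\<^sub>j\<close> of particles in column \<open>j\<close> per period. The rule in the first and last column says
  that \<open>2 X\<^sub>1 + X\<^sub>2\<close> and \<open>2 X\<^sub>n + X\<^bsub>n-1\<^esub>\<close> equal the period.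

  For \<open>X\<^sub>j = X\<^bsub>n+1-j\<^esub>\<close>, each particle at \<open>(k, j)\<close> has exactly one successor among \<open>(k + 1, j + 1)\<close> and
  \<open>(k, j + 2)\<close>, so the particles split into snakes running from column \<open>1\<close> to column \<open>n\<close>. The step
  sequence of the next snake is that of the present one rotated by one place. Hence if a snake has
  reached column \<open>j\<close> after \<open>i\<close> of its \<open>r\<close> steps, the \<open>i\<close>-th snake after it begins with the remaining
  \<open>r - i\<close> steps and thereby reaches column \<open>n + 1 - j\<close>. This injection moves particles by a bounded
  time, so it yields an inequality of densities, and symmetry in \<open>j\<close> yields equality.\<close>

section \<open>Local consequences of the board rule\<close>

locale path_board =
  fixes n :: nat and x :: "nat \<Rightarrow> nat \<Rightarrow> bool"
  assumes n_ge_2: "n \<ge> 2"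
    and outside: "j = 0 \<or> n < j \<Longrightarrow> \<not> x k j"
    and step: "1 \<le> j \<Longrightarrow> j \<le> n \<Longrightarrow>
      x (Suc k) j \<longleftrightarrow> \<not> x k j \<and> \<not> x (Suc k) (j - 1) \<and> \<not> x k (Suc j)"
begin

lemma inside: "x k j \<Longrightarrow> 1 \<le> j \<and> j \<le> n"
  using outside[of j k] by linarith

lemma not_below: "x k j \<Longrightarrow> \<not> x (Suc k) j"
  using step[of j k] inside by blast

lemma not_below_left: "x k (Suc j) \<Longrightarrow> \<not> x (Suc k) j"
  using step[of j k] inside by blast

lemma not_right: "x (Suc k) j \<Longrightarrow> \<not> x (Suc k) (Suc j)"
  using step[of "Suc j" k] inside by force

text \<open>The particle at \<open>(k, j)\<close> clears \<open>(k, j + 1)\<close> and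
  \<open>(k + 1, j)\<close>, which leaves \<open>(k, j + 2)\<close> as the only possible blocker of
  \<open>(k + 1, j + 1)\<close>. Row 0 is free initial data, so exclusion within a row holds from
  row 1 on.\<close>

lemma successor:
  assumes "x k j" "k \<ge> 1" "j < n"
  shows "x (Suc k) (Suc j) \<longleftrightarrow> \<not> x k (Suc (Suc j))"
proof -
  have "\<not> x k (Suc j)"
    using not_right[of "k - 1" j] assms by simp
  then show ?thesis
    using step[of "Suc j" k] not_below[OF assms(1)] assms by simp
qed

lemma predecessor:
  assumes "x (Suc k) (Suc j)" "j \<ge> 1"
  shows "x k j \<or> x (Suc k) (j - 1)"
proof -
  have "\<not> x (Suc k) j" "\<not> x k (Suc j)"
    using step[of "Suc j" k] inside[OF assms(1)] assms(1) by auto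
  then show ?thesis
    using step[of j k] inside[OF assms(1)] assms(2) by auto
qed

lemma parallel_step_1:
  assumes "x k (Suc j)" "x (k + 2) j" "k \<ge> 1" "Suc j < n"
  shows "x (k + 3) (Suc j) \<longleftrightarrow> x (Suc k) (j + 2)"
proof -
  have q: "x (k + 3) (Suc j) \<longleftrightarrow> \<not> x (k + 2) (j + 2)"
    using successor[of "k + 2" j] assms by (simp add: numeral_3_eq_3)
  have p: "x (Suc k) (j + 2) \<longleftrightarrow> \<not> x k (j + 3)"
    using successor[of k "Suc j"] assms by (simp add: numeral_3_eq_3)
  have "\<not> x (k + 2) (Suc j)"
    using not_right[of "k + 1" j] assms by simp
  moreover have "\<not> x (Suc k) (j + 3)" if "x k (j + 3)"
    using not_below that by blast
  ultimately show ?thesis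
    using q p step[of "j + 2" "Suc k"] assms by (auto simp: numeral_3_eq_3)
qed

lemma parallel_step_2:
  assumes "x k (j + 2)" "x (k + 2) j" "k \<ge> 1" "j + 2 < n"
  shows "x (k + 3) (Suc j) \<longleftrightarrow> x (Suc k) (j + 3)"
proof -
  have q: "x (k + 3) (Suc j) \<longleftrightarrow> \<not> x (k + 2) (j + 2)"
    using successor[of "k + 2" j] assms by (simp add: numeral_3_eq_3)
  have "\<not> x (k + 2) (Suc j)"
    using not_right[of "k + 1" j] assms by simp
  moreover have "\<not> x (Suc k) (j + 2)"
    using not_below assms by blast
  ultimately show ?thesis
    using q step[of "j + 2" "Suc k"] assms by (auto simp: numeral_3_eq_3)
qed

text \<open>Particles of consecutive snakes at either of these offsets make the same kind of step,
  so the offset persists. This is the source of the rotation property: the first step of a snake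
  fixes its offset to the next snake.\<close>

lemma parallel_step:
  assumes "x k j" "x (k + 2) j'" "k \<ge> 1" "j < n" "j = j' + 1 \<or> j = j' + 2"
  shows "x (k + 3) (Suc j') \<longleftrightarrow> x (Suc k) (Suc j)"
  using assms parallel_step_1[of k j'] parallel_step_2[of k j']
  by (auto simp: numeral_3_eq_3)

lemma ex_start: "\<exists>k\<ge>1. x k 1"
proof (rule ccontr)
  assume "\<not> ?thesis"
  then have "\<not> x 1 1" "\<not> x 2 1" "\<not> x 3 1"
    by auto
  moreover have "\<not> x 2 2" if "x 1 2"
    using not_below[OF that] by (simp add: numeral_2_eq_2)
  ultimately show False
    using step[of 1 1] step[of 1 2] outside[of 0] n_ge_2
    by (auto simp: numeral_2_eq_2 numeral_3_eq_3)
qed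

end

section \<open>Snakes and their rotation property\<close>

locale path_board_start = path_board +
  fixes k0 :: nat
  assumes k0: "k0 \<ge> 1" "x k0 1"
begin

text \<open>The times at which column \<open>1\<close> is occupied, from \<open>k0\<close> on.\<close>

primrec K :: "nat \<Rightarrow> nat" where
  "K 0 = k0"
| "K (Suc s) = K s + (if x (Suc (K s)) 2 then 3 else 2)"

lemma K_Suc: "K (Suc s) = K s + 2 \<or> K (Suc s) = K s + 3"
  by simp

declare K.simps(2) [simp del]

lemma K_add: "K s + 2 * i \<le> K (s + i)" "K (s + i) \<le> K s + 3 * i"
proof (induction i)
  case (Suc i)
  { case 1 show ?case using Suc K_Suc[of "s + i"] by (simp del: K.simps) linarith }
  { case 2 show ?case using Suc K_Suc[of "s + i"] by (simp del: K.simps) linarith }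
qed auto

lemma K_ge: "K s \<ge> k0"
  using K_add(1)[of 0 s] by simp

text \<open>A particle at \<open>(K s + 1, 2)\<close> keeps column 1 empty for one further row; this
  is the difference between the gaps 3 and 2.\<close>

lemma K_start: "x (K s) 1"
proof (induction s)
  case 0
  then show ?case using k0 by simp
next
  case (Suc s)
  have 1: "\<not> x (Suc (K s)) 1"
    using not_below[OF Suc.IH] .
  show ?case
  proof (cases "x (Suc (K s)) 2")
    case True
    have "\<not> x (K s + 2) 1" "\<not> x (K s + 2) 2"
      using not_below_left[of "Suc (K s)" 1] not_below[OF True] True by (auto simp: numeral_2_eq_2)
    then show ?thesis
      using True step[of 1 "K s + 2"] outside[of 0] n_ge_2
      by (simp add: K.simps(2) numeral_3_eq_3 numeral_2_eq_2)
  next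
    case False
    then show ?thesis
      using 1 step[of 1 "Suc (K s)"] outside[of 0] n_ge_2
      by (simp add: K.simps(2) numeral_2_eq_2)
  qed
qed

lemma ex_K_eq:
  assumes "x k 1" "k \<ge> k0"
  shows "\<exists>s. k = K s"
proof -
  have fin: "finite {s. K s \<le> k}"
  proof (rule finite_subset)
    show "{s. K s \<le> k} \<subseteq> {..k}"
    proof
      fix s assume "s \<in> {s. K s \<le> k}"
      then show "s \<in> {..k}" using K_add(1)[of 0 s] by simp
    qed
  qed simp
  define s where "s = Max {s. K s \<le> k}"
  have "0 \<in> {s. K s \<le> k}" using assms by simp
  then have s: "K s \<le> k"
    using Max_in[OF fin] unfolding s_def by blast
  have "\<not> K (Suc s) \<le> k"
    using Max_ge[OF fin, of "Suc s"] unfolding s_def by auto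
  \<comment> \<open>Since \<open>k\<close> precedes the next start, only the rows between two starts
    remain, and column 1 is empty there.\<close>
  then consider "k = K s" | "k = Suc (K s)" | "k = Suc (Suc (K s))" "x (Suc (K s)) 2"
    using s by (fastforce simp: K.simps(2) split: if_splits)
  then show ?thesis
  proof cases
    case 2
    then show ?thesis using not_below[OF K_start] assms by blast
  next
    case 3
    then show ?thesis using not_below_left[of "Suc (K s)" 1] assms by (simp add: numeral_2_eq_2)
  qed blast
qed

text \<open>\<open>(k, j)\<close> is the position of the snake starting at time \<open>K s\<close> after \<open>i\<close> steps. By the rotation
  property, its next step has the column width of the first step of snake \<open>s + i\<close>, which is
  \<open>4 - (K (s + i + 1) - K (s + i))\<close>; so the column telescopes to \<open>1 + 4 i - (K (s + i) - K s)\<close>.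
  The equations are arranged to avoid subtraction.\<close>

definition snake :: "nat \<Rightarrow> nat \<Rightarrow> nat \<Rightarrow> nat \<Rightarrow> bool" where
  "snake s i k j \<longleftrightarrow> k + 2 * i = K (s + i) \<and> j + K (s + i) = K s + 4 * i + 1"

lemma ex_snake: "\<exists>k j. snake s i k j"
  unfolding snake_def using K_add[of s i]
  by (intro exI[of _ "K (s + i) - 2 * i"] exI[of _ "K s + 4 * i + 1 - K (s + i)"]) auto

lemma snake_functional:
  assumes "snake s i k j" "snake s i k' j'"
  shows "k = k'" "j = j'"
  using assms unfolding snake_def by auto

text \<open>A gap 3 of \<open>K\<close> gives the diagonal step, a gap 2 the step by two columns
  within the row.\<close>

lemma snake_Suc:
  assumes "snake s i k j"
  shows "snake s (Suc i) (Suc k) (Suc j) \<or> snake s (Suc i) k (j + 2)"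
  using assms K_Suc[of "s + i"] unfolding snake_def by auto

lemma snake_bounds:
  assumes "snake s i k j"
  shows "k \<ge> 1" "j \<ge> i + 1"
  using assms K_add[of s i] K_ge[of s] k0(1) unfolding snake_def by auto

text \<open>Both positions involve the same \<open>K (s + i + 1)\<close>, so the rows differ by 2
  and the columns by 4 minus the gap between \<open>K s\<close> and \<open>K (Suc s)\<close>. These
  are the offsets of \<open>parallel_step\<close>.\<close>

lemma snake_shift:
  assumes "snake s (Suc i) k j"
  obtains j' where "snake (Suc s) i (k + 2) j'" "j = j' + 1 \<or> j = j' + 2"
proof -
  obtain k' j' where *: "snake (Suc s) i k' j'"
    using ex_snake by blast
  have "k' = k + 2" "j = j' + 1 \<or> j = j' + 2"
    using * assms K_Suc[of s] unfolding snake_def by auto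
  with * show thesis using that by blast
qed

text \<open>The premise \<open>on\<close> serves as induction hypothesis in \<open>snake_on\<close>.
  The step from \<open>p\<close> agrees with the step from \<open>q\<close>, a position of the next
  snake at index \<open>i - 1\<close>. That step ends at index \<open>i\<close> and in a column at
  most \<open>j + 1 \<le> n\<close>, so \<open>on\<close> decides it.\<close>

lemma snake_step:
  assumes p: "snake s i k j" and "j < n"
    and on: "\<And>i' s k j. i' \<le> i \<Longrightarrow> snake s i' k j \<Longrightarrow> j \<le> n \<Longrightarrow> x k j"
  shows "x (Suc k) (Suc j) \<longleftrightarrow> snake s (Suc i) (Suc k) (Suc j)"
proof (cases i)
  case 0
  then show ?thesis
    using p K.simps(2)[of s] by (auto simp: snake_def numeral_2_eq_2)
next
  case (Suc i')
  obtain j' where q: "snake (Suc s) i' (k + 2) j'" and j': "j = j' + 1 \<or> j = j' + 2"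
    using snake_shift p Suc by blast
  have xp: "x k j"
    using on[OF _ p] \<open>j < n\<close> by simp
  have xq: "x (k + 2) j'"
    using on[OF _ q] Suc j' \<open>j < n\<close> by auto
  have "x (k + 3) (Suc j') \<longleftrightarrow> x (Suc k) (Suc j)"
    using parallel_step[OF xp xq] snake_bounds[OF p] j' \<open>j < n\<close> by blast
  moreover have "x (k + 3) (Suc j') \<longleftrightarrow> \<not> x (k + 2) (j' + 2)"
    using successor[OF xq] j' \<open>j < n\<close> by (auto simp: numeral_3_eq_3)
  moreover have "x (k + 3) (Suc j')" if "snake (Suc s) i (k + 3) (Suc j')"
    using on[OF _ that] j' \<open>j < n\<close> by auto
  moreover have "x (k + 2) (j' + 2)" if "snake (Suc s) i (k + 2) (j' + 2)"
    using on[OF _ that] j' \<open>j < n\<close> by auto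
  moreover have "snake (Suc s) i (k + 3) (Suc j') \<or> snake (Suc s) i (k + 2) (j' + 2)"
    using snake_Suc[OF q] Suc by (simp add: numeral_3_eq_3)
  moreover have "snake s (Suc i) (Suc k) (Suc j) \<longleftrightarrow> snake (Suc s) i (k + 3) (Suc j')"
    using p q Suc by (auto simp: snake_def)
  ultimately show ?thesis by blast
qed

lemma snake_on:
  assumes "snake s i k j" "j \<le> n"
  shows "x k j"
  using assms
\<comment> \<open>The snake is left arbitrary because the steps of snake \<open>s\<close> are
  decided by snake \<open>Suc s\<close>.\<close>
proof (induction i arbitrary: s k j rule: less_induct)
  case (less i)
  show ?case
  proof (cases i)
    case 0
    then show ?thesis using less.prems K_start by (simp add: snake_def)
  next
    case (Suc i')
    obtain k' j' where p: "snake s i' k' j'"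
      using ex_snake by blast
    have kj: "k = Suc k' \<and> j = Suc j' \<or> k = k' \<and> j = j' + 2"
      using snake_Suc[OF p] less.prems(1) Suc unfolding snake_def by auto
    then have j': "j' < n"
      using less.prems(2) by auto
    have xp: "x k' j'"
      using less.IH[OF _ p] Suc j' by simp
    have "x (Suc k') (Suc j') \<longleftrightarrow> snake s (Suc i') (Suc k') (Suc j')"
      using snake_step[OF p j'] less.IH Suc by (metis le_imp_less_Suc)
    moreover have "x (Suc k') (Suc j') \<longleftrightarrow> \<not> x k' (j' + 2)"
      using successor[OF xp] snake_bounds[OF p] j' by simp
    moreover have "snake s (Suc i') (Suc k') (Suc j') \<longleftrightarrow> k = Suc k'"
      using less.prems(1) Suc p kj by (auto simp: snake_def)
    ultimately show ?thesis using kj by auto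
  qed
qed

text \<open>This includes steps that would land in column \<open>n + 1\<close>, about which
  \<open>snake_on\<close> is silent.\<close>

lemma snake_next:
  assumes "snake s i k j" "j < n"
  shows "x (Suc k) (Suc j) \<longleftrightarrow> snake s (Suc i) (Suc k) (Suc j)"
    and "x k (j + 2) \<longleftrightarrow> snake s (Suc i) k (j + 2)"
proof -
  show 1: "x (Suc k) (Suc j) \<longleftrightarrow> snake s (Suc i) (Suc k) (Suc j)"
    using snake_step[OF assms] snake_on by blast
  have "x (Suc k) (Suc j) \<longleftrightarrow> \<not> x k (j + 2)"
    using successor snake_on assms snake_bounds by (metis add_2_eq_Suc' less_imp_le)
  then show "x k (j + 2) \<longleftrightarrow> snake s (Suc i) k (j + 2)"
    using 1 snake_Suc[OF assms(1)] by (auto simp: snake_def)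
qed

text \<open>Columns strictly increase, and a snake cannot leap from \<open>n - 1\<close> to
  \<open>n + 1\<close>, because by \<open>snake_next\<close> a particle would then sit outside the
  board.\<close>

lemma snake_reaches_n: "\<exists>r k. snake s r k n"
proof -
  have "\<exists>i k j. snake s i k j \<and> n \<le> j"
    using ex_snake[of s n] snake_bounds(2) by (metis add_leD1)
  then obtain i k j where i: "snake s i k j" "n \<le> j"
    and least: "\<And>i' k j. i' < i \<Longrightarrow> snake s i' k j \<Longrightarrow> j < n"
    using exists_least_iff[of "\<lambda>i. \<exists>k j. snake s i k j \<and> n \<le> j"] by (metis not_le)
  obtain i' where i': "i = Suc i'"
    using i n_ge_2 by (cases i) (auto simp: snake_def)
  obtain k' j' where p: "snake s i' k' j'"
    using ex_snake by blast
  have j': "j' < n"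
    using least p i' by blast
  show ?thesis
    using snake_Suc[OF p]
  proof
    assume "snake s (Suc i') (Suc k') (Suc j')"
    moreover from this have "Suc j' = n"
      using i i' j' by (auto simp: snake_def)
    ultimately show ?thesis by auto
  next
    assume *: "snake s (Suc i') k' (j' + 2)"
    then have "x k' (j' + 2)"
      using snake_next(2)[OF p j'] by blast
    then have "j' + 2 = n"
      using i i' snake_functional(2)[OF *] inside[of k' "j' + 2"] by auto
    then show ?thesis
      using \<open>snake s (Suc i') k' (j' + 2)\<close> by auto
  qed
qed

text \<open>Tracing predecessors back to column 1 lowers the row by at most one for each column, so
  the trace ends no earlier than row \<open>k0\<close>, where every particle of column 1 is a
  start.\<close>

lemma on_snake:
  assumes "x k j" "k \<ge> k0 + j"
  shows "\<exists>s i. snake s i k j"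
  using assms
proof (induction j arbitrary: k rule: less_induct)
  case (less j)
  have j: "1 \<le> j" "j \<le> n"
    using inside less.prems by auto
  show ?case
  proof (cases "j = 1")
    case True
    then obtain s where "k = K s"
      using ex_K_eq[of k] less.prems by auto
    then have "snake s 0 k j"
      using True by (simp add: snake_def)
    then show ?thesis by blast
  next
    case False
    define l where "l = j - 1"
    have l: "j = Suc l" "l \<ge> 1"
      using False j by (auto simp: l_def)
    obtain k' where k': "k = Suc k'"
      using less.prems j by (cases k) auto
    consider "x k' l" | "x k (l - 1)"
      using predecessor[of k' l] less.prems l k' by auto
    then show ?thesis
    proof cases
      case 1
      then obtain s i where "snake s i k' l"
        using less.IH[of l k'] less.prems l k' by auto
      then show ?thesis
        using snake_next(1)[of s i k' l] less.prems l k' j by auto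
    next
      case 2
      then have "l \<ge> 2"
        using inside[OF 2] by linarith
      moreover have "\<exists>s i. snake s i k (l - 1)"
        by (rule less.IH) (use 2 less.prems l in auto)
      then obtain s i where "snake s i k (l - 1)"
        by blast
      ultimately show ?thesis
        using snake_next(2)[of s i k "l - 1"] less.prems l j by auto
    qed
  qed
qed

section \<open>Reflection of snake positions\<close>

lemma snake_unique:
  assumes "snake s i k j" "snake s' i' k j"
  shows "s = s' \<and> i = i'"
proof -
  have *: "s = s' \<and> i = i'" if "s \<le> s'" "snake s i k j" "snake s' i' k j" for s i s' i'
  proof -
    \<comment> \<open>The two equations compare \<open>k + j - 1\<close> and \<open>k\<close>. Since
      each gap of \<open>K\<close> is 2 or 3, they leave no freedom for \<open>s\<close> and
      \<open>i\<close>.\<close>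
    have eq: "K s + 2 * i = K s' + 2 * i'" "K (s + i) + 2 * i' = K (s' + i') + 2 * i"
      using that by (auto simp: snake_def)
    have 1: "K s + 2 * (s' - s) \<le> K s'" "K s' \<le> K s + 3 * (s' - s)"
      using K_add[of s "s' - s"] that(1) by auto
    then have "s' + i' \<le> s + i"
      using eq that(1) by linarith
    then have "K (s + i) \<le> K (s' + i') + 3 * ((s + i) - (s' + i'))"
      using K_add(2)[of "s' + i'" "(s + i) - (s' + i')"] by simp
    then show ?thesis
      using 1 eq that(1) \<open>s' + i' \<le> s + i\<close> by linarith
  qed
  show ?thesis
    using *[of s s' i i'] *[of s' s i' i] assms by linarith
qed

lemma snake_le_end:
  assumes "snake s i k j" "snake s r k' n" "j \<le> n"
  shows "i \<le> r"
proof (rule ccontr)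
  assume *: "\<not> i \<le> r"
  then have "K (s + i) \<le> K (s + r) + 3 * (i - r)"
    using K_add(2)[of "s + r" "i - r"] by simp
  then show False
    using assms * unfolding snake_def by linarith
qed

text \<open>With the potential \<open>4 * t - K t\<close>, a snake from \<open>s\<close> to index
  \<open>i\<close> crosses the potential difference between \<open>s\<close> and
  \<open>s + i\<close>. The part between \<open>s + i\<close> and \<open>s + r\<close> is
  \<open>n - j\<close>, and this is what snake \<open>s + i\<close> crosses in \<open>r - i\<close>
  steps.\<close>

lemma snake_reflect:
  assumes "snake s i k j" "snake s r k' n" "j \<le> n"
  obtains l where "snake (s + i) (r - i) l (n + 1 - j)" "l \<le> k + 2 * n"
proof -
  have "i \<le> r"
    using snake_le_end assms by blast
  obtain l j' where l: "snake (s + i) (r - i) l j'"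
    using ex_snake by blast
  have "j' = n + 1 - j"
    using l assms \<open>i \<le> r\<close> by (auto simp: snake_def)
  \<comment> \<open>Snake \<open>s + i\<close> starts in row \<open>k + 2 * i\<close> and gains at
    most one row per step; both \<open>i\<close> and \<open>r\<close> are below
    \<open>n\<close>.\<close>
  moreover have "l \<le> k + 2 * n"
    using l assms \<open>i \<le> r\<close> K_add(2)[of "s + i" "r - i"] snake_bounds(2)[OF assms(2)]
    by (auto simp: snake_def)
  ultimately show thesis
    using that l by blast
qed

text \<open>The image determines \<open>s + i\<close> and \<open>r - i\<close>, hence
  \<open>s + r\<close>. Ending in column \<open>n\<close> then fixes \<open>s\<close>, because the
  potential \<open>4 * t - K t\<close> is strictly increasing.\<close>

lemma snake_reflect_unique:
  assumes "snake s i k j" "snake s r kr n" "snake (s + i) (r - i) l j'" "j \<le> n"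
    and "snake s' i' k' j" "snake s' r' kr' n" "snake (s' + i') (r' - i') l j'"
  shows "k = k'"
proof -
  have t: "s + i = s' + i'" and "r - i = r' - i'"
    using snake_unique assms by blast+
  then have R: "s + r = s' + r'"
    using snake_le_end[OF assms(1,2,4)] snake_le_end[OF assms(5,6,4)] by linarith
  have *: "s = s'" if "s \<le> s'" "s + r = s' + r'" "snake s r kr n" "snake s' r' kr' n"
    for s s' r r' kr kr'
    using that K_add(2)[of s "s' - s"] by (auto simp: snake_def)
  have "s = s'"
    using *[of s s' r r'] *[of s' s r' r] R assms by (metis le_cases)
  then show ?thesis
    using t assms snake_functional(1) by auto
qed

text \<open>The error consists of the rows below \<open>k0 + j\<close>, whose particles need not lie
  on a snake, and of the \<open>2 * n\<close> rows by which images may pass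
  \<open>N\<close>.\<close>

lemma card_reflect_le:
  assumes "1 \<le> j" "j \<le> n"
  shows "card {k. k < N \<and> x k j} \<le> card {k. k < N \<and> x k (n + 1 - j)} + (k0 + 3 * n)"
proof -
  define A where "A = {k. k0 + j \<le> k \<and> k < N \<and> x k j}"
  define B where "B = {k. k < N + 2 * n \<and> x k (n + 1 - j)}"
  define R where "R k l \<longleftrightarrow> (\<exists>s i r kr. snake s i k j \<and> snake s r kr n \<and>
    snake (s + i) (r - i) l (n + 1 - j) \<and> l \<le> k + 2 * n)" for k l
  have "\<forall>k\<in>A. \<exists>l. R k l"
  proof
    fix k assume "k \<in> A"
    then obtain s i where p: "snake s i k j"
      using on_snake unfolding A_def by blast
    obtain r kr where r: "snake s r kr n"
      using snake_reaches_n by blast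
    obtain l where "snake (s + i) (r - i) l (n + 1 - j)" "l \<le> k + 2 * n"
      using snake_reflect[OF p r assms(2)] .
    with p r show "\<exists>l. R k l"
      unfolding R_def by blast
  qed
  then obtain f where f: "\<And>k. k \<in> A \<Longrightarrow> R k (f k)"
    by metis
  have "inj_on f A"
  proof (rule inj_onI)
    fix k k' assume "k \<in> A" "k' \<in> A" "f k = f k'"
    then have "R k (f k)" "R k' (f k)"
      using f by metis+
    then obtain s i r kr s' i' r' kr' where
      "snake s i k j" "snake s r kr n" "snake (s + i) (r - i) (f k) (n + 1 - j)"
      "snake s' i' k' j" "snake s' r' kr' n" "snake (s' + i') (r' - i') (f k) (n + 1 - j)"
      unfolding R_def by metis
    then show "k = k'"
      by (rule snake_reflect_unique[OF _ _ _ assms(2)])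
  qed
  moreover have "f ` A \<subseteq> B"
  proof
    fix l assume "l \<in> f ` A"
    then obtain k where k: "k \<in> A" "l = f k" by blast
    then have "x l (n + 1 - j)" "l \<le> k + 2 * n"
      using f[OF k(1)] snake_on assms(1) unfolding R_def by auto
    then show "l \<in> B"
      using k unfolding A_def B_def by auto
  qed
  moreover have "finite B"
    unfolding B_def by simp
  ultimately have "card A \<le> card B"
    by (metis card_inj_on_le)
  moreover have "card {k. k < N \<and> x k j} \<le> card (A \<union> {..<k0 + j})"
    by (rule card_mono) (auto simp: A_def)
  moreover have "card (A \<union> {..<k0 + j}) \<le> card A + (k0 + j)"
    using card_Un_le[of A "{..<k0 + j}"] by simp
  moreover have "card B \<le> card ({k. k < N \<and> x k (n + 1 - j)} \<union> {N..<N + 2 * n})"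
    by (rule card_mono) (auto simp: B_def)
  moreover have "card ({k. k < N \<and> x k (n + 1 - j)} \<union> {N..<N + 2 * n})
      \<le> card {k. k < N \<and> x k (n + 1 - j)} + 2 * n"
    using card_Un_le[of "{k. k < N \<and> x k (n + 1 - j)}" "{N..<N + 2 * n}"] by simp
  ultimately show ?thesis
    using assms(2) by linarith
qed

end

section \<open>Periodic sums and column counts\<close>

lemma sum_shift_periodic:
  fixes f :: "nat \<Rightarrow> 'a::cancel_comm_monoid_add"
  assumes "\<And>k. f (k + P) = f k"
  shows "(\<Sum>k<P. f (k + h)) = (\<Sum>k<P. f k)"
proof (induction h)
  case (Suc h)
  have "(\<Sum>k<P. f (k + Suc h)) + f h = (\<Sum>k<Suc P. f (k + h))"
    by (subst sum.lessThan_Suc_shift) (simp add: add.commute)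
  also have "\<dots> = (\<Sum>k<P. f (k + h)) + f h"
    using assms[of h] by (simp add: add.commute)
  finally show ?case using Suc by simp
qed simp

lemma sum_periodic:
  fixes f :: "nat \<Rightarrow> nat"
  assumes "\<And>k. f (k + P) = f k"
  shows "(\<Sum>k<m * P. f k) = m * (\<Sum>k<P. f k)"
proof (induction m)
  case (Suc m)
  have "f (k + m * P) = f k" for k
    by (induction m arbitrary: k) (simp_all add: assms add.assoc[symmetric])
  then have "(\<Sum>k<P. f (m * P + k)) = (\<Sum>k<P. f k)"
    by (simp add: add.commute)
  moreover have "(\<Sum>k<m * P + Q. f k) = (\<Sum>k<m * P. f k) + (\<Sum>k<Q. f (m * P + k))" for Q
    by (induction Q) (simp_all add: add.assoc)
  ultimately have "(\<Sum>k<m * P + P. f k) = (\<Sum>k<m * P. f k) + (\<Sum>k<P. f k)"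
    by simp
  then show ?case using Suc by (simp add: add.commute)
qed simp

lemma le_if_multiples_le:
  fixes a b C :: nat
  assumes "\<And>m. m * a \<le> m * b + C"
  shows "a \<le> b"
proof (rule ccontr)
  assume "\<not> a \<le> b"
  \<comment> \<open>With \<open>Suc C\<close> multiples the difference of the two sides already
    exceeds the error \<open>C\<close>.\<close>
  then have "Suc C * Suc b \<le> Suc C * a"
    by (intro mult_le_mono) auto
  then show False
    using assms[of "Suc C"] by simp
qed

context path_board
begin

lemma sum_reflect:
  assumes per: "\<And>k j. x (k + P) j = x k j" and j: "1 \<le> j" "j \<le> n"
  shows "(\<Sum>k<P. of_bool (x k j) :: nat) = (\<Sum>k<P. of_bool (x k (n + 1 - j)))"
proof -
  obtain k0 where "k0 \<ge> 1" "x k0 1"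
    using ex_start by blast
  then interpret path_board_start n x k0
    by unfold_locales
  have card: "card {k. k < m * P \<and> x k i} = m * (\<Sum>k<P. of_bool (x k i))" for m i
  proof -
    have "card {k. k < m * P \<and> x k i} = (\<Sum>k<m * P. of_bool (x k i))"
      by (simp add: sum_of_bool_eq lessThan_def Int_def)
    then show ?thesis
      using sum_periodic[of "\<lambda>k. of_bool (x k i)" P m] per by simp
  qed
  have *: "(\<Sum>k<P. of_bool (x k i)) \<le> (\<Sum>k<P. of_bool (x k (n + 1 - i)) :: nat)"
    if "1 \<le> i" "i \<le> n" for i
  proof (rule le_if_multiples_le)
    show "m * (\<Sum>k<P. of_bool (x k i)) \<le> m * (\<Sum>k<P. of_bool (x k (n + 1 - i))) + (k0 + 3 * n)" for m
      using card_reflect_le[OF that, of "m * P"] unfolding card .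
  qed
  show ?thesis
    using *[of j] *[of "n + 1 - j"] j by (simp add: le_antisym)
qed

text \<open>Exactly one of \<open>(k + 1, 1)\<close>, \<open>(k + 2, 1)\<close>,
  \<open>(k + 1, 2)\<close> is occupied. Rows start at \<open>k + 1\<close> to have exclusion within
  the row; periodicity removes the shift.\<close>

lemma sum_first:
  assumes per: "\<And>k j. x (k + P) j = x k j"
  shows "2 * (\<Sum>k<P. of_bool (x k 1)) + (\<Sum>k<P. of_bool (x k 2)) = P"
proof -
  have "of_bool (x (k + 1) 1) + of_bool (x (k + 2) 1) + of_bool (x (k + 1) 2) = (1::nat)" for k
  proof -
    have "x (Suc (Suc k)) 1 \<longleftrightarrow> \<not> x (Suc k) 1 \<and> \<not> x (Suc k) 2"
      using step[of 1 "Suc k"] outside[of 0 "Suc (Suc k)"] n_ge_2 by (simp add: numeral_2_eq_2)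
    moreover have "\<not> (x (Suc k) 1 \<and> x (Suc k) 2)"
      using not_right[of k 1] by (auto simp: numeral_2_eq_2)
    ultimately show ?thesis
      by auto
  qed
  then have "(\<Sum>k<P. of_bool (x (k + 1) 1) + of_bool (x (k + 2) 1) + of_bool (x (k + 1) 2)) = P"
    by simp
  moreover have "(\<Sum>k<P. of_bool (x (k + h) i)) = (\<Sum>k<P. of_bool (x k i) :: nat)" for h i
    by (rule sum_shift_periodic) (simp add: per)
  ultimately show ?thesis
    by (simp only: sum.distrib mult_2)
qed

lemma sum_last:
  assumes per: "\<And>k j. x (k + P) j = x k j"
  shows "2 * (\<Sum>k<P. of_bool (x k n)) + (\<Sum>k<P. of_bool (x k (n - 1))) = P"
proof -
  have "of_bool (x k n) + of_bool (x (k + 1) n) + of_bool (x (k + 1) (n - 1)) = (1::nat)" for k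
  proof -
    have "x (Suc k) n \<longleftrightarrow> \<not> x k n \<and> \<not> x (Suc k) (n - 1)"
      using step[of n k] outside[of "Suc n" k] n_ge_2 by simp
    moreover have "\<not> (x k n \<and> x (Suc k) (n - 1))"
      using not_below_left[of k "n - 1"] n_ge_2 by auto
    ultimately show ?thesis
      by auto
  qed
  then have "(\<Sum>k<P. of_bool (x k n) + of_bool (x (k + 1) n) + of_bool (x (k + 1) (n - 1))) = P"
    by simp
  moreover have "(\<Sum>k<P. of_bool (x (k + h) i)) = (\<Sum>k<P. of_bool (x k i) :: nat)" for h i
    by (rule sum_shift_periodic) (simp add: per)
  ultimately show ?thesis
    by (simp only: sum.distrib mult_2)
qed

end

section \<open>Zigzag ideals as particle configurations\<close>

definition occupied :: "nat \<Rightarrow> nat set \<Rightarrow> nat \<Rightarrow> bool" where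
  "occupied n I j \<longleftrightarrow> 1 \<le> j \<and> j \<le> n \<and> (j \<in> I \<longleftrightarrow> even j)"

lemma zigzag_iff:
  "(a, b) \<in> zigzag n \<longleftrightarrow>
     a \<in> {1..n} \<and> b \<in> {1..n} \<and> (a = b \<or> even b \<and> (b = Suc a \<or> a = Suc b))"
proof -
  have "(\<exists>i. a = 2 * i - 1 \<and> b = 2 * i \<and> 2 * i - 1 \<in> {1..n} \<and> 2 * i \<in> {1..n}) \<longleftrightarrow>
      a \<in> {1..n} \<and> b \<in> {1..n} \<and> even b \<and> b = Suc a"
    unfolding atLeastAtMost_iff by presburger
  moreover have "(\<exists>i. a = 2 * i + 1 \<and> b = 2 * i \<and> 2 * i + 1 \<in> {1..n} \<and> 2 * i \<in> {1..n}) \<longleftrightarrow>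
      a \<in> {1..n} \<and> b \<in> {1..n} \<and> even b \<and> a = Suc b"
    unfolding atLeastAtMost_iff by presburger
  ultimately show ?thesis
    unfolding zigzag_def Un_iff mem_Collect_eq prod.inject Id_on_iff by blast
qed

text \<open>An even element inside with a neighbouring odd element missing is exactly a pair of
  adjacent particles.\<close>

lemma order_ideals_zigzag_iff:
  "I \<in> order_ideals (zigzag n) \<longleftrightarrow>
    I \<subseteq> {1..n} \<and> (\<forall>j. \<not> (occupied n I j \<and> occupied n I (Suc j)))"
proof -
  have "(\<forall>a b. b \<in> I \<and> (a, b) \<in> zigzag n \<longrightarrow> a \<in> I) \<longleftrightarrow>
      (\<forall>j. \<not> (occupied n I j \<and> occupied n I (Suc j)))"
    if "I \<subseteq> {1..n}"
  proof (intro iffI allI impI notI)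
    fix j
    assume *: "\<forall>a b. b \<in> I \<and> (a, b) \<in> zigzag n \<longrightarrow> a \<in> I"
      "occupied n I j \<and> occupied n I (Suc j)"
    show False
      using *(2) *(1)[rule_format, of j "Suc j"] *(1)[rule_format, of "Suc j" j]
      by (cases "even j") (auto simp: occupied_def zigzag_iff)
  next
    fix a b
    assume *: "\<forall>j. \<not> (occupied n I j \<and> occupied n I (Suc j))" "b \<in> I \<and> (a, b) \<in> zigzag n"
    show "a \<in> I"
      using *(2) *(1)[rule_format, of a] *(1)[rule_format, of b]
      by (auto simp: occupied_def zigzag_iff)
  qed
  then show ?thesis
    unfolding order_ideals_def by auto
qed

text \<open>Flipping membership of \<open>a\<close> flips its occupation. Removing a particle never
  creates an adjacent pair; adding one does so iff a neighbour is occupied.\<close>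

lemma occupied_toggle:
  assumes I: "I \<in> order_ideals (zigzag n)" and a: "a \<in> {1..n}"
  shows "occupied n (toggle (zigzag n) a I) j \<longleftrightarrow>
    (if j = a then \<not> occupied n I a \<and> \<not> occupied n I (a - 1) \<and> \<not> occupied n I (Suc a)
     else occupied n I j)"
proof -
  define F where "F = (if a \<in> I then I - {a} else I \<union> {a})"
  have occupied_F: "occupied n F j \<longleftrightarrow> (if j = a then \<not> occupied n I a else occupied n I j)" for j
    using a by (auto simp: F_def occupied_def)
  have toggle: "toggle (zigzag n) a I = (if F \<in> order_ideals (zigzag n) then F else I)"
    using I by (auto simp: toggle_def F_def)
  have "F \<subseteq> {1..n}" and ind: "\<And>j. \<not> (occupied n I j \<and> occupied n I (Suc j))"
    using I a unfolding order_ideals_zigzag_iff F_def by auto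
  then have "F \<in> order_ideals (zigzag n) \<longleftrightarrow> (\<forall>j. \<not> (occupied n F j \<and> occupied n F (Suc j)))"
    by (simp add: order_ideals_zigzag_iff)
  also have "\<dots> \<longleftrightarrow> occupied n I a \<or> \<not> occupied n I (a - 1) \<and> \<not> occupied n I (Suc a)"
  proof
    assume *: "\<forall>j. \<not> (occupied n F j \<and> occupied n F (Suc j))"
    show "occupied n I a \<or> \<not> occupied n I (a - 1) \<and> \<not> occupied n I (Suc a)"
      using *[rule_format, of a] *[rule_format, of "a - 1"] a
      by (auto simp: occupied_F split: if_splits)
  next
    assume "occupied n I a \<or> \<not> occupied n I (a - 1) \<and> \<not> occupied n I (Suc a)"
    then show "\<forall>j. \<not> (occupied n F j \<and> occupied n F (Suc j))"
      using ind by (auto simp: occupied_F)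
  qed
  finally show ?thesis
    using toggle occupied_F ind[of a] ind[of "a - 1"] a by auto
qed

section \<open>Coxeter elements as local update rules\<close>

lemma foldr_toggle_in_order_ideals:
  "I \<in> order_ideals r \<Longrightarrow> foldr (toggle r) as I \<in> order_ideals r"
  by (induction as) (auto simp: toggle_in_order_ideals)

lemma foldr_toggle_group:
  assumes "I \<in> order_ideals r" "set as \<subseteq> Field r"
  shows "foldr (\<lambda>a g. toggle r a \<otimes>\<^bsub>toggle_group r\<^esub> g) as \<one>\<^bsub>toggle_group r\<^esub> I =
    foldr (toggle r) as I"
proof -
  let ?G = "BijGroup (order_ideals r)"
  have G: "monoid.mult (toggle_group r) = monoid.mult ?G" "one (toggle_group r) = one ?G"
    by (simp_all add: toggle_group_def)
  interpret G: group ?G by (rule group_BijGroup)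
  let ?w = "\<lambda>as. foldr (\<lambda>a g. toggle r a \<otimes>\<^bsub>?G\<^esub> g) as \<one>\<^bsub>?G\<^esub>"
  have carrier: "?w as \<in> carrier ?G" for as
    by (induction as) (auto simp: toggle_in_BijGroup)
  have "?w as I = foldr (toggle r) as I"
  proof (induction as)
    case Nil
    then show ?case using assms(1) by (simp add: BijGroup_def)
  next
    case (Cons a as)
    have "(toggle r a \<otimes>\<^bsub>?G\<^esub> ?w as) I = toggle r a (?w as I)"
      using carrier[of as] toggle_in_BijGroup[of r a] assms(1)
      by (simp add: BijGroup_def compose_def)
    then show ?case using Cons by simp
  qed
  then show ?thesis
    unfolding G .
qed

lemma occupied_foldr_other:
  assumes "I \<in> order_ideals (zigzag n)" "set as \<subseteq> {1..n}" "j \<notin> set as"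
  shows "occupied n (foldr (toggle (zigzag n)) as I) j = occupied n I j"
  using assms(2,3)
proof (induction as)
  case (Cons a as)
  then show ?case
    using occupied_toggle[OF foldr_toggle_in_order_ideals[OF assms(1)], of a as j] by simp
qed simp

text \<open>The rightmost toggle acts first and each site is toggled once. When \<open>j\<close> is
  toggled, the sites in \<open>vs\<close> thus already have their final state, all others their
  initial one.\<close>

lemma occupied_foldr:
  fixes I us vs n j
  defines "J \<equiv> foldr (toggle (zigzag n)) (us @ j # vs) I"
  assumes I: "I \<in> order_ideals (zigzag n)"
    and as: "distinct (us @ j # vs)" "set (us @ j # vs) \<subseteq> {1..n}"
  shows "occupied n J j \<longleftrightarrow> \<not> occupied n I j
     \<and> \<not> occupied n (if j - 1 \<in> set vs then J else I) (j - 1)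
     \<and> \<not> occupied n (if Suc j \<in> set vs then J else I) (Suc j)"
proof -
  define V where "V = foldr (toggle (zigzag n)) vs I"
  define T where "T = toggle (zigzag n) j V"
  have V: "V \<in> order_ideals (zigzag n)"
    unfolding V_def by (rule foldr_toggle_in_order_ideals[OF I])
  then have T: "T \<in> order_ideals (zigzag n)"
    unfolding T_def by (rule toggle_in_order_ideals)
  have J: "J = foldr (toggle (zigzag n)) us T"
    by (simp add: J_def T_def V_def)
  have V_bit: "occupied n V i = occupied n I i" if "i \<notin> set vs" for i
    unfolding V_def using occupied_foldr_other[OF I] as that by auto
  have J_bit: "occupied n J i = occupied n T i" if "i \<notin> set us" for i
    unfolding J using occupied_foldr_other[OF T] as that by auto
  have T_bit: "occupied n T i = occupied n V i" if "i \<noteq> j" for i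
    unfolding T_def using occupied_toggle[OF V] as that by auto
  have *: "occupied n V i = occupied n (if i \<in> set vs then J else I) i" if "i \<noteq> j" for i
    using V_bit[of i] J_bit[of i] T_bit[of i] as that by auto
  have "occupied n J j \<longleftrightarrow> occupied n T j"
    using J_bit as by simp
  also have "\<dots> \<longleftrightarrow> \<not> occupied n V j \<and> \<not> occupied n V (j - 1) \<and> \<not> occupied n V (Suc j)"
    unfolding T_def using occupied_toggle[OF V, of j j] as(2) by simp
  also have "occupied n V j = occupied n I j"
    using V_bit as by simp
  also have "occupied n V (j - 1) = occupied n (if j - 1 \<in> set vs then J else I) (j - 1)"
    using as(2) by (intro *) auto
  also have "occupied n V (Suc j) = occupied n (if Suc j \<in> set vs then J else I) (Suc j)"
    by (intro *) auto
  finally show ?thesis .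
qed

text \<open>One bit per edge suffices: \<open>E j\<close> says that \<open>j + 1\<close> stands to
  the right of \<open>j\<close> in the product, so that it is toggled before
  \<open>j\<close>.\<close>

lemma coxeter_element_occupied:
  assumes "w \<in> coxeter_elements (zigzag n)"
  shows "\<exists>E. \<forall>I\<in>order_ideals (zigzag n). \<forall>j\<in>{1..n}.
    occupied n (w I) j \<longleftrightarrow> \<not> occupied n I j
      \<and> \<not> occupied n (if E (j - 1) then I else w I) (j - 1)
      \<and> \<not> occupied n (if E j then w I else I) (Suc j)"
proof -
  obtain as where as: "distinct as" "set as = {1..n}"
    and w: "w = foldr (\<lambda>a g. toggle (zigzag n) a \<otimes>\<^bsub>toggle_group (zigzag n)\<^esub> g) as
      \<one>\<^bsub>toggle_group (zigzag n)\<^esub>"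
    using assms unfolding coxeter_elements_def by auto
  have "\<forall>j\<in>set as. \<exists>i<length as. as ! i = j"
    by (simp add: in_set_conv_nth)
  then obtain p where p: "\<And>j. j \<in> set as \<Longrightarrow> p j < length as \<and> as ! p j = j"
    by metis
  have later: "i \<in> set (drop (Suc (p j)) as) \<longleftrightarrow> p j < p i" if "i \<in> set as" "j \<in> set as" for i j
  proof
    assume "i \<in> set (drop (Suc (p j)) as)"
    then obtain m where "m < length as - Suc (p j)" "as ! (Suc (p j) + m) = i"
      by (auto simp: in_set_conv_nth)
    then have "Suc (p j) + m = p i"
      using p[OF that(1)] as(1) by (simp add: nth_eq_iff_index_eq[symmetric])
    then show "p j < p i" by simp
  next
    assume "p j < p i"
    then have "drop (Suc (p j)) as ! (p i - Suc (p j)) = i"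
      "p i - Suc (p j) < length (drop (Suc (p j)) as)"
      using p[OF that(1)] by auto
    then show "i \<in> set (drop (Suc (p j)) as)"
      using nth_mem by metis
  qed
  have "occupied n (w I) j \<longleftrightarrow> \<not> occupied n I j
      \<and> \<not> occupied n (if p (j - 1) < p j then I else w I) (j - 1)
      \<and> \<not> occupied n (if p j < p (Suc j) then w I else I) (Suc j)"
    if I: "I \<in> order_ideals (zigzag n)" and j: "j \<in> {1..n}" for I j
  proof -
    define us vs where "us = take (p j) as" and "vs = drop (Suc (p j)) as"
    have split: "as = us @ j # vs"
      unfolding us_def vs_def using p[of j] j as(2) id_take_nth_drop by metis
    have "w I = foldr (toggle (zigzag n)) as I"
      unfolding w using foldr_toggle_group[OF I] as(2) by simp
    then have "occupied n (w I) j \<longleftrightarrow> \<not> occupied n I j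
       \<and> \<not> occupied n (if j - 1 \<in> set vs then w I else I) (j - 1)
       \<and> \<not> occupied n (if Suc j \<in> set vs then w I else I) (Suc j)"
      using occupied_foldr[OF I, of us j vs] as unfolding split[symmetric] by simp
    \<comment> \<open>The sites 0 and \<open>n + 1\<close> are always vacant, so the order of
      toggles matters only for neighbours inside the path.\<close>
    moreover have "\<not> occupied n A 0" "\<not> occupied n A (Suc n)" for A
      by (auto simp: occupied_def)
    moreover have "j - 1 \<in> set vs \<longleftrightarrow> \<not> p (j - 1) < p j" if "j \<noteq> 1"
    proof -
      have "j - 1 \<in> set as" "j \<in> set as"
        using j that as(2) by auto
      moreover from this have "p (j - 1) \<noteq> p j"
        using p j
        by (metis atLeastAtMost_iff diff_less less_irrefl less_numeral_extra(1) less_le_trans)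
      ultimately show ?thesis
        using later unfolding vs_def by auto
    qed
    moreover have "Suc j \<in> set vs \<longleftrightarrow> p j < p (Suc j)" if "j \<noteq> n"
      using later[of "Suc j" j] j that as(2) unfolding vs_def by auto
    ultimately show ?thesis
      by (cases "j = 1"; cases "j = n") auto
  qed
  then show ?thesis
    by (intro exI[of _ "\<lambda>j. p j < p (Suc j)"]) auto
qed

section \<open>Orbits as periodic boards\<close>

lemma orbit_enumeration:
  assumes "finite S" "bij_betw w S S" "I \<in> S"
  obtains P where "P > 0" "(w ^^ P) I = I" "bij_betw (\<lambda>k. (w ^^ k) I) {..<P} (orbit w I)"
proof -
  \<comment> \<open>Extending \<open>w\<close> by the identity outside \<open>S\<close> gives a
    permutation of the whole type with the same orbit of \<open>I\<close>.\<close>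
  define v where "v = (\<lambda>J. if J \<in> S then w J else J)"
  have "bij_betw v S S"
    using assms(2) by (rule bij_betw_cong[THEN iffD1, rotated]) (simp add: v_def)
  then have "v permutes S"
    by (rule bij_imp_permutes) (simp add: v_def)
  then have "permutation v"
    using assms(1) by (metis permutation_permutes)
  then have "I \<in> orbit v I"
    by (rule permutation_self_in_orbit)
  moreover have "orbit w I = orbit v I"
    using assms by (intro orbit_cong0[of I S]) (auto simp: v_def bij_betw_def)
  ultimately have I: "I \<in> orbit w I"
    by simp
  let ?P = "funpow_dist1 w I I"
  have "bij_betw (\<lambda>k. (w ^^ k) I) {..<?P} (orbit w I)"
    using inj_on_funpow_dist1[OF I] orbit_conv_funpow_dist1[OF I]
    by (simp add: bij_betw_def lessThan_atLeast0)
  then show thesis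
    using that[of ?P] funpow_dist1_prop[OF I] by simp
qed

lemma coxeter_orbit_counts:
  fixes n :: nat
  assumes n: "n \<ge> 2" and w: "w \<in> coxeter_elements (zigzag n)"
    and I: "I \<in> order_ideals (zigzag n)"
  obtains P X where "P > 0" "card (orbit w I) = P"
    "\<And>j. j \<in> {1..n} \<Longrightarrow> (\<Sum>J\<in>orbit w I. chi j J) =
      (if even j then of_nat (X j) else of_nat P - of_nat (X j) :: 'k::field_char_0)"
    "\<And>j. j \<in> {1..n} \<Longrightarrow> X j = X (n + 1 - j)"
    "2 * X 1 + X 2 = P" "2 * X n + X (n - 1) = P"
proof -
  let ?S = "order_ideals (zigzag n)"
  have "?S \<subseteq> Pow {1..n}"
    by (auto simp: order_ideals_def)
  then have "finite ?S"
    by (rule finite_subset) simp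
  have "w \<in> generate (BijGroup ?S) (toggle (zigzag n) ` Field (zigzag n))"
    using subsetD[OF coxeter_elements_subset w] by (simp add: toggle_group_def)
  then have "w \<in> carrier (BijGroup ?S)"
    by (rule group.generate_in_carrier[OF group_BijGroup, rotated]) (auto simp: toggle_in_BijGroup)
  then have bij: "bij_betw w ?S ?S"
    by (simp add: BijGroup_def Bij_def)
  then have iter: "(w ^^ k) I \<in> ?S" for k
    using I by (induction k) (auto simp: bij_betw_def)
  obtain P where P: "P > 0" "(w ^^ P) I = I"
    and orbit: "bij_betw (\<lambda>k. (w ^^ k) I) {..<P} (orbit w I)"
    using orbit_enumeration[OF \<open>finite ?S\<close> bij I] .
  have card: "card (orbit w I) = P"
    using bij_betw_same_card[OF orbit] by simp
  have sum: "(\<Sum>J\<in>orbit w I. f J) = (\<Sum>k<P. f ((w ^^ k) I))" for f :: "nat set \<Rightarrow> 'k"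
    using sum.reindex_bij_betw[OF orbit, of f] by simp
  obtain E where E: "\<forall>I\<in>?S. \<forall>j\<in>{1..n}.
    occupied n (w I) j \<longleftrightarrow> \<not> occupied n I j
      \<and> \<not> occupied n (if E (j - 1) then I else w I) (j - 1)
      \<and> \<not> occupied n (if E j then w I else I) (Suc j)"
    using coxeter_element_occupied[OF w] ..
  define y where "y k j = occupied n ((w ^^ k) I) j" for k j
  define h where "h j = (\<Sum>i<j. of_bool (E i) :: nat)" for j
  define x where "x k j = y (k + h j) j" for k j
  define X where "X j = (\<Sum>k<P. of_bool (x k j) :: nat)" for j
  have y_per: "y (k + P) j = y k j" for k j
    using P(2) by (simp add: y_def funpow_add)
  have x_per: "x (k + P) j = x k j" for k j
    using y_per[of "k + h j" j] by (simp add: x_def add_ac)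
  have h_Suc: "h (Suc j) = h j + of_bool (E j)" for j
    by (simp add: h_def)
  interpret path_board n x
  proof
    show "n \<ge> 2" by (rule n)
    show "\<not> x k j" if "j = 0 \<or> n < j" for k j
      using that by (auto simp: x_def y_def occupied_def)
    show "x (Suc k) j \<longleftrightarrow> \<not> x k j \<and> \<not> x (Suc k) (j - 1) \<and> \<not> x k (Suc j)"
      if j: "1 \<le> j" "j \<le> n" for k j
    proof -
      obtain i where i: "j = Suc i" using j by (cases j) auto
      define m where "m = k + h j"
      have "y (Suc m) j \<longleftrightarrow> \<not> y m j \<and> \<not> y (if E i then m else Suc m) i
          \<and> \<not> y (if E j then Suc m else m) (Suc j)"
        using E[rule_format, OF iter[of m], of j] j unfolding y_def i
        by (cases "E i"; cases "E (Suc i)") simp_all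
      \<comment> \<open>The shear absorbs the bits: either value of \<open>E i\<close> puts the left
        neighbour in row \<open>Suc k\<close> of \<open>x\<close>, and likewise the right neighbour
        in row \<open>k\<close>.\<close>
      moreover have "(if E i then m else Suc m) = Suc k + h i"
        by (simp add: m_def i h_Suc)
      moreover have "(if E j then Suc m else m) = k + h (Suc j)"
        by (simp add: m_def h_Suc)
      ultimately show ?thesis
        by (simp add: x_def m_def i)
    qed
  qed
  \<comment> \<open>The shear moves each column rigidly, so its count over a period is
    unchanged.\<close>
  have X: "X j = (\<Sum>k<P. of_bool (y k j))" for j
    unfolding X_def x_def by (rule sum_shift_periodic) (simp add: y_per)
  have "(\<Sum>J\<in>orbit w I. chi j J) = (if even j then of_nat (X j) else of_nat P - of_nat (X j) :: 'k)"
    if j: "j \<in> {1..n}" for j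
  proof -
    have "chi j ((w ^^ k) I) =
        (if even j then of_nat (of_bool (y k j)) else 1 - of_nat (of_bool (y k j)) :: 'k)" for k
      using j by (auto simp: chi_def y_def occupied_def)
    then show ?thesis
      by (simp add: sum X sum_subtractf)
  qed
  moreover have "X j = X (n + 1 - j)" if "j \<in> {1..n}" for j
    using sum_reflect[OF x_per, of j] that by (simp only: X_def atLeastAtMost_iff)
  ultimately show thesis
    using that[OF P(1) card, of X] sum_first[OF x_per] sum_last[OF x_per]
    by (simp only: X_def)
qed

theorem corollary5p9:
  fixes n :: nat and w :: "nat set \<Rightarrow> nat set"
  assumes "n \<ge> 2"
    and "w \<in> coxeter_elements (zigzag n)"
  shows
    "(odd n \<longrightarrow>
        (\<forall>j\<in>{1..n}. mesic (order_ideals (zigzag n)) w (0::'k::field_char_0)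
            (\<lambda>I. chi j I - chi (n + 1 - j) I))
      \<and> mesic (order_ideals (zigzag n)) w (1::'k) (\<lambda>I. 2 * chi 1 I - chi 2 I)
      \<and> mesic (order_ideals (zigzag n)) w (1::'k) (\<lambda>I. 2 * chi n I - chi (n - 1) I))
   \<and> (even n \<longrightarrow>
        (\<forall>j\<in>{1..n}. mesic (order_ideals (zigzag n)) w (1::'k)
            (\<lambda>I. chi j I + chi (n + 1 - j) I))
      \<and> mesic (order_ideals (zigzag n)) w (1::'k) (\<lambda>I. 2 * chi 1 I - chi 2 I)
      \<and> mesic (order_ideals (zigzag n)) w (0::'k) (\<lambda>I. 2 * chi n I - chi (n - 1) I))"
proof -
  let ?S = "order_ideals (zigzag n)"
  note counts = coxeter_orbit_counts[OF assms, where 'k = 'k]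
  have first: "mesic ?S w (1::'k) (\<lambda>I. 2 * chi 1 I - chi 2 I)"
    unfolding mesic_def
  proof
    fix I assume "I \<in> ?S"
    then show "(\<Sum>J\<in>orbit w I. 2 * chi 1 J - chi 2 J) / of_nat (card (orbit w I)) = (1::'k)"
    proof (rule counts, goal_cases)
      case (1 P X)
      have "(of_nat P :: 'k) = 2 * of_nat (X 1) + of_nat (X 2)"
        unfolding 1(5)[symmetric] by simp
      then have "(\<Sum>J\<in>orbit w I. 2 * chi 1 J - chi 2 J) = (1::'k) * of_nat P"
        using 1(3)[of 1] 1(3)[of 2] assms(1)
        by (simp add: sum_subtractf sum_distrib_left[symmetric])
      then show ?case
        using 1(1,2) by simp
    qed
  qed
  \<comment> \<open>For odd \<open>n\<close> the sum is
    \<open>2 * (P - X n) - X (n - 1) = P\<close>, for even \<open>n\<close> it is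
    \<open>2 * X n - (P - X (n - 1)) = 0\<close>.\<close>
  have last: "mesic ?S w (of_bool (odd n)::'k) (\<lambda>I. 2 * chi n I - chi (n - 1) I)"
    unfolding mesic_def
  proof
    fix I assume "I \<in> ?S"
    then show "(\<Sum>J\<in>orbit w I. 2 * chi n J - chi (n - 1) J) / of_nat (card (orbit w I))
        = (of_bool (odd n)::'k)"
    proof (rule counts, goal_cases)
      case (1 P X)
      have "(of_nat P :: 'k) = 2 * of_nat (X n) + of_nat (X (n - 1))"
        unfolding 1(6)[symmetric] by simp
      then have "(\<Sum>J\<in>orbit w I. 2 * chi n J - chi (n - 1) J) = (of_bool (odd n)::'k) * of_nat P"
        using 1(3)[of n] 1(3)[of "n - 1"] assms(1)
        by (simp add: sum_subtractf sum_distrib_left[symmetric])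
      then show ?case
        using 1(1,2) by simp
    qed
  qed
  \<comment> \<open>Parity decides between difference and sum: mirror sites have equal parity iff
    \<open>n\<close> is odd, and at odd sites \<open>chi\<close> counts vacancies.\<close>
  have reflect: "n + 1 - j \<in> {1..n}" "even (n + 1 - j) \<longleftrightarrow> (even j \<longleftrightarrow> odd n)"
    if "j \<in> {1..n}" for j
    using that by auto
  have odd: "mesic ?S w (0::'k) (\<lambda>I. chi j I - chi (n + 1 - j) I)" if "odd n" "j \<in> {1..n}" for j
    unfolding mesic_def
  proof
    fix I assume "I \<in> ?S"
    then show "(\<Sum>J\<in>orbit w I. chi j J - chi (n + 1 - j) J) / of_nat (card (orbit w I)) = (0::'k)"
    proof (rule counts, goal_cases)
      case (1 P X)
      have "X (n + 1 - j) = X j"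
        using 1(4)[of j] that by simp
      then have "(\<Sum>J\<in>orbit w I. chi j J - chi (n + 1 - j) J) = (0::'k) * of_nat P"
        using 1(3)[OF that(2)] 1(3)[OF reflect(1)[OF that(2)]] reflect(2)[OF that(2)] that(1)
        by (simp add: sum_subtractf)
      then show ?case
        using 1(1,2) by simp
    qed
  qed
  have even: "mesic ?S w (1::'k) (\<lambda>I. chi j I + chi (n + 1 - j) I)" if "even n" "j \<in> {1..n}" for j
    unfolding mesic_def
  proof
    fix I assume "I \<in> ?S"
    then show "(\<Sum>J\<in>orbit w I. chi j J + chi (n + 1 - j) J) / of_nat (card (orbit w I)) = (1::'k)"
    proof (rule counts, goal_cases)
      case (1 P X)
      have "X (n + 1 - j) = X j"
        using 1(4)[of j] that by simp
      then have "(\<Sum>J\<in>orbit w I. chi j J + chi (n + 1 - j) J) = (1::'k) * of_nat P"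
        using 1(3)[OF that(2)] 1(3)[OF reflect(1)[OF that(2)]] reflect(2)[OF that(2)] that(1)
        by (simp add: sum.distrib)
      then show ?case
        using 1(1,2) by simp
    qed
  qed
  show ?thesis
    using first last odd even by (cases "odd n") simp_all
qed

end
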